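(* Let $n\ge 6$. Every convex equal-area $n$-gon has at least six sextactic edges, i.e. there are at least six indices $i\in\{1,\dots,n\}$ (indices modulo $n$) such that $\Delta\mu(i)\cdot\Delta\mu(i+1)\le 0$.
   Context: $[u,v]$ denotes the determinant of two plane vectors. Let $P$ be a polygon with vertices $P_1,\dots,P_n\in\mathbb{R}^2$, $n\ge 5$, all indices taken modulo $n$, and oriented sides $\mathbf{v}_{i+\frac12}=P_{i+1}-P_i$. $P$ is a convex equal-area $n$-gon if it is a simple polygon bounding a convex planar domain, no three consecutive vertices are collinear, and $[\mathbf{v}_{i-\frac12},\mathbf{v}_{i+\frac12}]=[\mathbf{v}_{i+\frac12},\mathbf{v}_{i+\frac32}]$ for every $i$. The polygon is normalized, by applying an affine transformation, so that this common determinant equals $1$. Then $P_{i+2}-P_{i-1}$ is parallel to $\mathbf{v}_{i+\frac12}$, and the discrete affine curvature $\mu_{i+\frac12}$ of the edge $\mathbf{v}_{i+\frac12}$ is the real number defined by $P_{i+2}-P_{i-1}=(3-\mu_{i+\frac12})\mathbf{v}_{i+\frac12}$. Put $\Delta\mu(i)=\mu_{i+\frac12}-\mu_{i-\frac12}$. An edge $\mathbf{v}_{i+\frac12}$ is called sextactic if $\Delta\mu(i)\cdot\Delta\mu(i+1)\le 0$. *)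

theory Defs
  imports "HOL-Analysis.Analysis"
begin

text \<open>
  A closed polygon with \<open>n\<close> vertices is an \<open>n\<close>-periodic map \<open>P :: int \<Rightarrow> real^2\<close>,
  so that indices are read modulo \<open>n\<close>. Half-integer indices are rounded down: an object
  attached to the side from \<open>P i\<close> to \<open>P (i + 1)\<close> carries the index \<open>i\<close>.
\<close>

definition det2 :: "real^2 \<Rightarrow> real^2 \<Rightarrow> real"
  where "det2 u v = det (vector [u, v] :: real^2^2)"

lemma det2_eq: "det2 u v = u $ 1 * v $ 2 - u $ 2 * v $ 1"
  by (simp add: det2_def det_2 vector_2)

definition closed_polygon :: "nat \<Rightarrow> (int \<Rightarrow> real^2) \<Rightarrow> bool"
  where "closed_polygon n P \<longleftrightarrow> (\<forall>i. P (i + int n) = P i)"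

definition side_vec :: "(int \<Rightarrow> real^2) \<Rightarrow> int \<Rightarrow> real^2"
  where "side_vec P i = P (i + 1) - P i"

definition side :: "(int \<Rightarrow> real^2) \<Rightarrow> int \<Rightarrow> (real^2) set"
  where "side P i = closed_segment (P i) (P (i + 1))"

text \<open>
  As the vertices are distinct, the second condition says that (for \<open>n \<ge> 3\<close>) two
  consecutive sides meet exactly in their common vertex and other pairs of sides are disjoint.
\<close>

definition simple_polygon :: "nat \<Rightarrow> (int \<Rightarrow> real^2) \<Rightarrow> bool"
  where "simple_polygon n P \<longleftrightarrow>
    closed_polygon n P \<and>
    inj_on P {0..<int n} \<and>
    (\<forall>i\<in>{0..<int n}. \<forall>j\<in>{0..<int n}. i \<noteq> j \<longrightarrow>
       side P i \<inter> side P j \<subseteq> {P i, P (i + 1)} \<inter> {P j, P (j + 1)})"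

definition bounds_convex_domain :: "nat \<Rightarrow> (int \<Rightarrow> real^2) \<Rightarrow> bool"
  where "bounds_convex_domain n P \<longleftrightarrow>
    (\<exists>D. open D \<and> bounded D \<and> D \<noteq> {} \<and> convex D \<and>
         frontier D = (\<Union>i\<in>{0..<int n}. side P i))"

text \<open>
  The common value of the determinants is not fixed to be \<open>1\<close>: the curvature below is
  invariant under affine transformations, so normalizing the polygon does not change it.
\<close>

definition convex_equal_area_polygon :: "nat \<Rightarrow> (int \<Rightarrow> real^2) \<Rightarrow> bool"
  where "convex_equal_area_polygon n P \<longleftrightarrow>
    5 \<le> n \<and> simple_polygon n P \<and> bounds_convex_domain n P \<and>
    (\<forall>i. \<not> collinear {P (i - 1), P i, P (i + 1)}) \<and>
    (\<forall>i. det2 (side_vec P (i - 1)) (side_vec P i) = det2 (side_vec P i) (side_vec P (i + 1)))"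

definition affine_curvature :: "(int \<Rightarrow> real^2) \<Rightarrow> int \<Rightarrow> real"
  where "affine_curvature P i =
    (THE m. P (i + 2) - P (i - 1) = (3 - m) *\<^sub>R side_vec P i)"

definition curvature_diff :: "(int \<Rightarrow> real^2) \<Rightarrow> int \<Rightarrow> real"
  where "curvature_diff P i = affine_curvature P i - affine_curvature P (i - 1)"

definition sextactic :: "(int \<Rightarrow> real^2) \<Rightarrow> int \<Rightarrow> bool"
  where "sextactic P i \<longleftrightarrow> curvature_diff P i * curvature_diff P (i + 1) \<le> 0"

lemma affine_curvature_ex1:
  assumes "convex_equal_area_polygon n P"
  shows "\<exists>!m. P (i + 2) - P (i - 1) = (3 - m) *\<^sub>R side_vec P i"
proof -
  define v where "v = side_vec P i"
  define w where "w = P (i + 2) - P (i - 1)"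
  have nc: "\<not> collinear {P (i - 1), P i, P (i + 1)}"
    using assms by (simp add: convex_equal_area_polygon_def)
  have "v \<noteq> 0"
  proof
    assume "v = 0"
    then have "P (i + 1) = P i" by (simp add: v_def side_vec_def)
    with nc show False by simp
  qed
  then have v: "v $ 1 \<noteq> 0 \<or> v $ 2 \<noteq> 0" by (auto simp: vec_eq_iff forall_2)
  have "det2 (side_vec P (i - 1)) v = det2 v (side_vec P (i + 1))"
    using assms by (simp add: convex_equal_area_polygon_def v_def)
  then have par: "w $ 1 * v $ 2 = w $ 2 * v $ 1"
    by (simp add: det2_eq side_vec_def v_def w_def algebra_simps)
  have "\<exists>c. w = c *\<^sub>R v"
  proof (cases "v $ 1 = 0")
    case True
    with v par show ?thesis
      by (intro exI[of _ "w $ 2 / v $ 2"]) (auto simp: vec_eq_iff forall_2 field_simps)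
  next
    case False
    with par show ?thesis
      by (intro exI[of _ "w $ 1 / v $ 1"]) (auto simp: vec_eq_iff forall_2 field_simps)
  qed
  then obtain c where c: "w = c *\<^sub>R v" by blast
  show ?thesis
  proof (rule ex1I[of _ "3 - c"])
    show "P (i + 2) - P (i - 1) = (3 - (3 - c)) *\<^sub>R side_vec P i"
      using c by (simp add: w_def v_def)
    show "m = 3 - c" if "P (i + 2) - P (i - 1) = (3 - m) *\<^sub>R side_vec P i" for m
      using that c \<open>v \<noteq> 0\<close> by (simp add: w_def v_def)
  qed
qed

lemma affine_curvature:
  assumes "convex_equal_area_polygon n P"
  shows "P (i + 2) - P (i - 1) = (3 - affine_curvature P i) *\<^sub>R side_vec P i"
  unfolding affine_curvature_def by (rule theI'[OF affine_curvature_ex1[OF assms]])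

end

theory Submission
  imports Defs
begin

text \<open>
  The coordinates of the vertices and the constant sequence solve
  \<open>x (i + 2) - x (i - 1) = (3 - \<mu> i) (x (i + 1) - x i)\<close>, and summation by parts shows
  that \<open>\<Delta>\<mu>\<close> is orthogonal to the product of any two periodic solutions, that is, to every
  polynomial of degree at most two restricted to the vertices. The number of sign changes of \<open>\<Delta>\<mu>\<close> around the
  polygon is even. If it were at most four, the product of at most two affine functions vanishing at the midpoints
  of the corresponding edges would, by convexity, have the same sign pattern as \<open>\<Delta>\<mu>\<close>, contradicting
  orthogonality.
\<close>

section \<open>Periodic sequences\<close>

lemma sum_periodic_shift:
  fixes f :: "int \<Rightarrow> 'a::comm_monoid_add"
  assumes f: "\<And>i. f (i + int n) = f i"
  shows "sum f {a..<a + int n} = sum f {b..<b + int n}"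
proof -
  have step: "sum f {a..<a + int n} = sum f {a + 1..<a + 1 + int n}" for a
  proof (cases "n = 0")
    case False
    then have "{a..<a + int n} = insert a {a + 1..<a + int n}"
      and "{a + 1..<a + 1 + int n} = insert (a + int n) {a + 1..<a + int n}"
      by auto
    then show ?thesis by (simp add: f)
  qed simp
  show ?thesis
  proof (induction a rule: int_induct[where k = b])
    case (step2 i)
    then show ?case using step[of "i - 1"] by simp
  qed (use step in simp_all)
qed

lemma sum_periodic_diff:
  fixes T :: "int \<Rightarrow> 'a::ab_group_add"
  assumes "\<And>i. T (i + int n) = T i"
  shows "(\<Sum>i\<in>{a..<a + int n}. T (i + 1) - T i) = 0"
proof -
  have "(\<Sum>i\<in>{a..<a + int n}. T (i + 1)) = sum T {a + 1..<a + 1 + int n}"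
    by (rule sum.reindex_bij_witness[of _ "\<lambda>i. i - 1" "\<lambda>i. i + 1"]) auto
  then show ?thesis
    using sum_periodic_shift[of T, OF assms, of a "a + 1"] by (simp add: sum_subtractf)
qed

lemma card_periodic_shift:
  assumes "\<And>i. Q (i + int n) \<longleftrightarrow> Q i"
  shows "card {i \<in> {a..<a + int n}. Q i} = card {i \<in> {b..<b + int n}. Q i}"
proof -
  have "card {i \<in> {c..<c + int n}. Q i} = (\<Sum>i\<in>{c..<c + int n}. of_bool (Q i))" for c
    by (simp add: Int_def)
  then show ?thesis
    using sum_periodic_shift[of "\<lambda>i. of_bool (Q i) :: nat" n a b] assms by simp
qed

lemma next_int:
  fixes a b :: int
  assumes "a < b" "Q b"
  obtains k where "a < k" "k \<le> b" "Q k" "\<And>i. a < i \<Longrightarrow> i < k \<Longrightarrow> \<not> Q i"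
proof -
  define m where "m = (LEAST m. Q (a + 1 + int m))"
  have ex: "Q (a + 1 + int (nat (b - a - 1)))" using assms by simp
  then have "Q (a + 1 + int m)" unfolding m_def by (rule LeastI)
  moreover have "m \<le> nat (b - a - 1)" unfolding m_def using ex by (rule Least_le)
  moreover have "\<not> Q i" if "a < i" "i < a + 1 + int m" for i
  proof
    assume "Q i"
    then have "Q (a + 1 + int (nat (i - a - 1)))" using that by simp
    then have "m \<le> nat (i - a - 1)" unfolding m_def by (rule Least_le)
    then show False using that by linarith
  qed
  ultimately show ?thesis using assms(1) by (intro that[of "a + 1 + int m"]) auto
qed

section \<open>Sign changes of a sequence orthogonal to products\<close>

text \<open>Because \<open>d\<close> is positive at both ends of the window, descents and ascents
  alternate: \<open>k1\<close>, \<open>k3\<close>, \<open>k5\<close> are first negative indices and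
  \<open>k2\<close>, \<open>k4\<close>, \<open>k6\<close> first positive ones. If no negative index
  followed after zero, one or two such pairs, a product of as many functions from \<open>sep\<close>
  would violate \<open>orth\<close>.\<close>

lemma six_sign_changes_aux:
  fixes d :: "int \<Rightarrow> real" and sol :: "(int \<Rightarrow> real) \<Rightarrow> bool"
  assumes d: "\<And>i. d (i + int n) = d i"
    and per: "\<And>g i. sol g \<Longrightarrow> g (i + int n) = g i"
    and one: "sol (\<lambda>_. 1)"
    and sep: "\<And>k l. k < l \<Longrightarrow> l < k + int n \<Longrightarrow>
        \<exists>g. sol g \<and> (\<forall>i\<in>{k..<l}. g i < 0) \<and> (\<forall>i\<in>{l..<k + int n}. 0 < g i)"
    and orth: "\<And>g h a. sol g \<Longrightarrow> sol h \<Longrightarrow> (\<Sum>i\<in>{a..<a + int n}. d i * g i * h i) = 0"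
    and pos: "0 < d a" and n: "0 < n"
  shows "6 \<le> card {i \<in> {a..<a + int n}. d i * d (i + 1) \<le> 0}"
proof -
  let ?b = "a + int n"
  \<comment> \<open>A weak sign match on the rest of the window suffices, because the term at
    \<open>a\<close> is strictly positive.\<close>
  have contra: False if "sol g" "sol h" and "0 < g a * h a"
    and nn: "\<And>i. a < i \<Longrightarrow> i < ?b \<Longrightarrow> 0 \<le> d i * (g i * h i)" for g h
  proof -
    have "0 < d a * (g a * h a)" using pos that(3) by simp
    then have "0 < (\<Sum>i\<in>{a..<?b}. d i * (g i * h i))"
      using n nn by (intro sum_pos2[of _ a]) (auto simp: order.order_iff_strict)
    then show False using orth[OF that(1,2), of a] by (simp add: mult.assoc)
  qed
  have db: "0 < d ?b" using pos d by simp
  \<comment> \<open>The period in \<open>sep\<close> starts at \<open>k\<close>, not at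
    \<open>a\<close>; an index in \<open>{a..<k}\<close> is moved by \<open>int n\<close> into
    \<open>{l..<k + int n}\<close>.\<close>
  have sep': "\<exists>g. sol g \<and> (\<forall>i\<in>{k..<l}. g i < 0) \<and> (\<forall>i\<in>{a..<k}. 0 < g i) \<and> (\<forall>i\<in>{l..<?b}. 0 < g i)"
    if kl: "a < k" "k < l" "l \<le> ?b" for k l
  proof -
    obtain g where g: "sol g" "\<forall>i\<in>{k..<l}. g i < 0" "\<forall>i\<in>{l..<k + int n}. 0 < g i"
      using sep[of k l] kl by auto
    have "0 < g i" if "i \<in> {a..<k}" for i
      using g(3) kl that per[OF g(1), of i] by (auto dest: bspec[of _ _ "i + int n"])
    then show ?thesis using g kl by (intro exI[of _ g]) auto
  qed
  have next_neg: "\<exists>k. j < k \<and> k < ?b \<and> d k < 0 \<and> (\<forall>i. j < i \<and> i < k \<longrightarrow> 0 \<le> d i)"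
    if "\<exists>k. j < k \<and> k < ?b \<and> d k < 0" for j
  proof -
    obtain k where k: "j < k" "k < ?b" "d k < 0" using \<open>\<exists>k. _\<close> by blast
    obtain k' where "j < k'" "k' \<le> k" "d k' < 0" "\<And>i. j < i \<Longrightarrow> i < k' \<Longrightarrow> \<not> d i < 0"
      using next_int[of j k "\<lambda>i. d i < 0"] k by blast
    then show ?thesis using k by (intro exI[of _ k']) (auto simp: not_less)
  qed
  have next_pos: "\<exists>k. j < k \<and> k \<le> ?b \<and> 0 < d k \<and> (\<forall>i. j < i \<and> i < k \<longrightarrow> d i \<le> 0)"
    if jb: "j < ?b" for j
  proof -
    obtain k where "j < k" "k \<le> ?b" "0 < d k" "\<And>i. j < i \<Longrightarrow> i < k \<Longrightarrow> \<not> 0 < d i"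
      using jb db by (rule next_int[where Q = "\<lambda>i. 0 < d i"]) blast
    then show ?thesis by (intro exI[of _ k]) (auto simp: not_less)
  qed
  have "\<exists>k. a < k \<and> k < ?b \<and> d k < 0"
  proof (rule ccontr)
    assume neg: "\<not> ?thesis"
    show False by (rule contra[OF one one]) (use neg in \<open>auto simp flip: not_less\<close>)
  qed
  then obtain k1 where k1: "a < k1" "k1 < ?b" "d k1 < 0" "\<And>i. a < i \<Longrightarrow> i < k1 \<Longrightarrow> 0 \<le> d i"
    using next_neg[of a] by blast
  obtain k2 where k2: "k1 < k2" "k2 \<le> ?b" "0 < d k2" "\<And>i. k1 < i \<Longrightarrow> i < k2 \<Longrightarrow> d i \<le> 0"
    using next_pos[of k1] k1(2) by blast
  obtain g where g: "sol g" "\<forall>i\<in>{k1..<k2}. g i < 0" "\<forall>i\<in>{a..<k1}. 0 < g i" "\<forall>i\<in>{k2..<?b}. 0 < g i"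
    using sep'[of k1 k2] k1 k2 by auto
  \<comment> \<open>A single negative block would be matched by \<open>g\<close> times the constant
    1.\<close>
  have "\<exists>k. k2 < k \<and> k < ?b \<and> d k < 0"
  proof (rule ccontr)
    assume neg: "\<not> ?thesis"
    have "0 \<le> d i * g i" if i: "a < i" "i < ?b" for i
    proof -
      consider "i < k1" | "i = k1" | "k1 < i" "i < k2" | "i = k2" | "k2 < i" by linarith
      then show ?thesis
      proof cases
        case 5
        then have "\<not> d i < 0" using neg i by blast
        moreover have "0 < g i" using 5 g(4) i by simp
        ultimately show ?thesis by (simp add: not_less)
      qed (use i k1 k2 g in \<open>auto simp: zero_le_mult_iff less_imp_le\<close>)
    qed
    then show False using contra[OF g(1) one] g(3) k1 by auto
  qed
  then obtain k3 where k3: "k2 < k3" "k3 < ?b" "d k3 < 0" "\<And>i. k2 < i \<Longrightarrow> i < k3 \<Longrightarrow> 0 \<le> d i"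
    using next_neg[of k2] by blast
  obtain k4 where k4: "k3 < k4" "k4 \<le> ?b" "0 < d k4" "\<And>i. k3 < i \<Longrightarrow> i < k4 \<Longrightarrow> d i \<le> 0"
    using next_pos[of k3] k3(2) by blast
  obtain h where h: "sol h" "\<forall>i\<in>{k3..<k4}. h i < 0" "\<forall>i\<in>{a..<k3}. 0 < h i" "\<forall>i\<in>{k4..<?b}. 0 < h i"
    using sep'[of k3 k4] k1 k2 k3 k4 by auto
  \<comment> \<open>Two negative blocks would be matched by the product of \<open>g\<close> and
    \<open>h\<close>, each negative on one block and positive on the other.\<close>
  have "\<exists>k. k4 < k \<and> k < ?b \<and> d k < 0"
  proof (rule ccontr)
    assume neg: "\<not> ?thesis"
    have "0 \<le> d i * (g i * h i)" if i: "a < i" "i < ?b" for i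
    proof -
      consider "i < k1" | "k1 \<le> i" "i < k2" | "k2 \<le> i" "i < k3" | "k3 \<le> i" "i < k4" | "k4 \<le> i"
        by linarith
      then show ?thesis
      proof cases
        case 1
        then have "0 \<le> d i" "0 < g i" "0 < h i" using i k1 k2 k3 g h by auto
        then show ?thesis by simp
      next
        case 2
        then have "d i \<le> 0" using k1 k2 by (cases "i = k1") auto
        moreover have "g i < 0" "0 < h i" using 2 i k3 g h by auto
        ultimately show ?thesis by (simp add: zero_le_mult_iff mult_le_0_iff)
      next
        case 3
        then have "0 \<le> d i" using k2 k3 by (cases "i = k2") auto
        moreover have "0 < g i" "0 < h i" using 3 i k3 g h by auto
        ultimately show ?thesis by simp
      next
        case 4
        then have "d i \<le> 0" using k3 k4 by (cases "i = k3") auto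
        moreover have "0 < g i" "h i < 0" using 4 i k3 g h by auto
        ultimately show ?thesis by (simp add: zero_le_mult_iff mult_le_0_iff)
      next
        case 5
        then have "\<not> d i < 0" using k4(3) neg i by (cases "i = k4") (simp, force)
        moreover have "0 < g i" "0 < h i" using 5 i k3 k4 g h by auto
        ultimately show ?thesis by (simp add: not_less)
      qed
    qed
    then show False using contra[OF g(1) h(1)] g(3) h(3) k1 k2 k3 by auto
  qed
  then obtain k5 where k5: "k4 < k5" "k5 < ?b" "d k5 < 0" "\<And>i. k4 < i \<Longrightarrow> i < k5 \<Longrightarrow> 0 \<le> d i"
    using next_neg[of k4] by blast
  obtain k6 where k6: "k5 < k6" "k6 \<le> ?b" "0 < d k6" "\<And>i. k5 < i \<Longrightarrow> i < k6 \<Longrightarrow> d i \<le> 0"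
    using next_pos[of k5] k5(2) by blast
  \<comment> \<open>Zeros may precede \<open>k\<close>, hence the weak inequality. Recording
    \<open>k - 1\<close> instead of \<open>k\<close> keeps the last change in the window even if
    \<open>k6\<close> is its right end.\<close>
  have down: "d (k - 1) * d (k - 1 + 1) \<le> 0"
    if "j < k" "0 < d j" "d k < 0" "\<And>i. j < i \<Longrightarrow> i < k \<Longrightarrow> 0 \<le> d i" for j k
    using that(1,2,3) that(4)[of "k - 1"] by (cases "j = k - 1") (auto simp: mult_le_0_iff)
  have up: "d (k - 1) * d (k - 1 + 1) \<le> 0"
    if "j < k" "d j < 0" "0 < d k" "\<And>i. j < i \<Longrightarrow> i < k \<Longrightarrow> d i \<le> 0" for j k
    using that(1,2,3) that(4)[of "k - 1"] by (cases "j = k - 1") (auto simp: mult_le_0_iff)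
  let ?K = "{k1 - 1, k2 - 1, k3 - 1, k4 - 1, k5 - 1, k6 - 1}"
  have "d (k1 - 1) * d (k1 - 1 + 1) \<le> 0" by (rule down[of a]) (use k1 pos in auto)
  moreover have "d (k2 - 1) * d (k2 - 1 + 1) \<le> 0" by (rule up[of k1]) (use k1 k2 in auto)
  moreover have "d (k3 - 1) * d (k3 - 1 + 1) \<le> 0" by (rule down[of k2]) (use k2 k3 in auto)
  moreover have "d (k4 - 1) * d (k4 - 1 + 1) \<le> 0" by (rule up[of k3]) (use k3 k4 in auto)
  moreover have "d (k5 - 1) * d (k5 - 1 + 1) \<le> 0" by (rule down[of k4]) (use k4 k5 in auto)
  moreover have "d (k6 - 1) * d (k6 - 1 + 1) \<le> 0" by (rule up[of k5]) (use k5 k6 in auto)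
  ultimately have "?K \<subseteq> {i \<in> {a..<?b}. d i * d (i + 1) \<le> 0}"
    using k1(1,2) k2(1,2) k3(1,2) k4(1,2) k5(1,2) k6(1,2) by simp
  then have "card ?K \<le> card {i \<in> {a..<?b}. d i * d (i + 1) \<le> 0}"
    by (rule card_mono[rotated]) (rule finite_subset[of _ "{a..<?b}"], auto)
  moreover have "card ?K = 6"
    using k2(1) k3(1) k4(1) k5(1) k6(1) by simp
  ultimately show ?thesis by simp
qed

text \<open>If \<open>d\<close> vanishes identically, all \<open>n\<close> indices count. Otherwise
  the window is rotated to start at a nonzero value, and passing to \<open>- d\<close> if necessary
  makes this value positive without changing any product \<open>d i * d (i + 1)\<close>.\<close>

lemma six_sign_changes:
  fixes d :: "int \<Rightarrow> real" and sol :: "(int \<Rightarrow> real) \<Rightarrow> bool"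
  assumes d: "\<And>i. d (i + int n) = d i"
    and per: "\<And>g i. sol g \<Longrightarrow> g (i + int n) = g i"
    and one: "sol (\<lambda>_. 1)"
    and sep: "\<And>k l. k < l \<Longrightarrow> l < k + int n \<Longrightarrow>
        \<exists>g. sol g \<and> (\<forall>i\<in>{k..<l}. g i < 0) \<and> (\<forall>i\<in>{l..<k + int n}. 0 < g i)"
    and orth: "\<And>g h a. sol g \<Longrightarrow> sol h \<Longrightarrow> (\<Sum>i\<in>{a..<a + int n}. d i * g i * h i) = 0"
    and n: "6 \<le> n"
  shows "6 \<le> card {i \<in> {1..int n}. d i * d (i + 1) \<le> 0}"
proof -
  have "d (i + int n) * d (i + int n + 1) = d i * d (i + 1)" for i
    using d[of i] d[of "i + 1"] by (simp add: ac_simps)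
  moreover have window: "{1..int n} = {1..<1 + int n}" by auto
  ultimately have shift: "card {i \<in> {1..int n}. d i * d (i + 1) \<le> 0} =
      card {i \<in> {a..<a + int n}. d i * d (i + 1) \<le> 0}" for a
    using card_periodic_shift[of "\<lambda>i. d i * d (i + 1) \<le> 0" n a 1]
    by (simp add: window)
  consider "\<forall>i. d i = 0" | a where "0 < d a" | a where "d a < 0"
    by (meson linorder_neqE_linordered_idom)
  then show ?thesis
  proof cases
    case 1
    then have "{i \<in> {1..int n}. d i * d (i + 1) \<le> 0} = {1..int n}" by auto
    then show ?thesis using n by simp
  next
    case 2
    then show ?thesis unfolding shift[of a]
      by (intro six_sign_changes_aux[where sol = sol]) (use assms in auto)
  next
    case 3
    then have "6 \<le> card {i \<in> {a..<a + int n}. - d i * - d (i + 1) \<le> 0}"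
      by (intro six_sign_changes_aux[where sol = sol])
        (use assms in \<open>auto simp: sum_negf\<close>)
    then show ?thesis unfolding shift[of a] by simp
  qed
qed

section \<open>Discrete third-order equation\<close>

text \<open>The recurrence equates the third difference of \<open>x\<close> with
  \<open>- \<mu> i\<close> times its first difference, a discrete form of x''' = - \<mu> x'. This
  makes each summand a forward difference of a periodic sequence.\<close>

lemma orthogonal_product_of_solutions:
  fixes \<mu> x y :: "int \<Rightarrow> real"
  assumes "\<And>i. \<mu> (i + int n) = \<mu> i" "\<And>i. x (i + int n) = x i" "\<And>i. y (i + int n) = y i"
    and x: "\<And>i. x (i + 2) - x (i - 1) = (3 - \<mu> i) * (x (i + 1) - x i)"
    and y: "\<And>i. y (i + 2) - y (i - 1) = (3 - \<mu> i) * (y (i + 1) - y i)"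
  shows "(\<Sum>i\<in>{a..<a + int n}. (\<mu> i - \<mu> (i - 1)) * x i * y i) = 0"
proof -
  \<comment> \<open>In the smooth case \<mu>' x y has the primitive \<mu> x y + x'' y - x' y' + x
    y''. The symmetrised products of neighbours minus \<open>3 * x i * y i\<close> discretise the
    last three terms.\<close>
  define T where "T i = \<mu> (i - 1) * x i * y i - 3 * x i * y i +
      (x (i + 1) * y (i - 1) + x (i - 1) * y (i + 1) + x (i + 1) * y i + x i * y (i + 1)
        + x i * y (i - 1) + x (i - 1) * y i) / 2" for i
  have "(\<mu> i - \<mu> (i - 1)) * x i * y i = T (i + 1) - T i" for i
  proof -
    have eq: "x (i + 2) = x (i - 1) + (3 - \<mu> i) * (x (i + 1) - x i)"
      "y (i + 2) = y (i - 1) + (3 - \<mu> i) * (y (i + 1) - y i)"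
      using x[of i] y[of i] by linarith+
    show ?thesis by (simp add: T_def eq field_simps)
  qed
  moreover have "T (i + int n) = T i" for i
    using assms(1)[of "i - 1"] assms(2,3)[of i] assms(2,3)[of "i - 1"] assms(2,3)[of "i + 1"]
    by (simp add: T_def algebra_simps)
  ultimately show ?thesis by (simp add: sum_periodic_diff)
qed

section \<open>Convex position of the vertices\<close>

lemma det2_algebra:
  "det2 (u + v) w = det2 u w + det2 v w" "det2 w (u + v) = det2 w u + det2 w v"
  "det2 (u - v) w = det2 u w - det2 v w" "det2 w (u - v) = det2 w u - det2 w v"
  "det2 (r *\<^sub>R u) w = r * det2 u w" "det2 w (r *\<^sub>R u) = r * det2 w u"
  "det2 u u = 0"
  by (simp_all add: det2_eq algebra_simps)

lemma det2_skew: "det2 u v = - det2 v u"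
  by (simp add: det2_eq)

lemma det2_eq_0_imp_parallel:
  assumes "det2 u w = 0" "u \<noteq> 0"
  obtains t where "w = t *\<^sub>R u"
proof (cases "u $ 1 = 0")
  case True
  then show ?thesis using assms
    by (intro that[of "w $ 2 / u $ 2"]) (auto simp: det2_eq vec_eq_iff forall_2)
next
  case False
  then show ?thesis using assms
    by (intro that[of "w $ 1 / u $ 1"]) (auto simp: det2_eq vec_eq_iff forall_2 field_simps)
qed

lemma closed_polygon_mod:
  assumes "closed_polygon n P"
  shows "P (k mod int n) = P k" "P (k mod int n + 1) = P (k + 1)"
proof -
  have per: "P (k + int n * m) = P k" for k m
  proof (induction m rule: int_induct[where k = 0])
    case (step1 m)
    have "P (k + int n * m + int n) = P (k + int n * m)"
      using assms unfolding closed_polygon_def by blast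
    then show ?case using step1 by (simp add: algebra_simps)
  next
    case (step2 m)
    have "P (k + int n * (m - 1) + int n) = P (k + int n * (m - 1))"
      using assms unfolding closed_polygon_def by blast
    then show ?case using step2 by (simp add: algebra_simps)
  qed simp
  have "k mod int n + int n * (k div int n) = k" by simp
  then show "P (k mod int n) = P k" using per[of "k mod int n" "k div int n"] by simp
  have "k mod int n + 1 + int n * (k div int n) = k + 1" by simp
  then show "P (k mod int n + 1) = P (k + 1)"
    using per[of "k mod int n + 1" "k div int n"] by simp
qed

text \<open>Take a supporting line of the convex domain at the midpoint of the edge. Both endpoints
  lie on its closed side and average to a point on it, so both lie on it: it is the line of the
  edge.\<close>

lemma edge_supporting_line:
  assumes "bounds_convex_domain n P" "closed_polygon n P" "0 < n" "P i \<noteq> P (i + 1)"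
  shows "(\<forall>k. 0 \<le> det2 (side_vec P i) (P k - P i)) \<or> (\<forall>k. det2 (side_vec P i) (P k - P i) \<le> 0)"
proof -
  obtain D where D: "open D" "D \<noteq> {}" "convex D" "frontier D = (\<Union>i\<in>{0..<int n}. side P i)"
    using assms(1) unfolding bounds_convex_domain_def by blast
  have side: "side P k \<subseteq> frontier D" for k
  proof -
    note closed_polygon_mod[OF assms(2), of k]
    then have "side P k = side P (k mod int n)" by (simp add: side_def)
    moreover have "k mod int n \<in> {0..<int n}" using assms(3) by simp
    ultimately show ?thesis unfolding D(4) by blast
  qed
  have cl: "P k \<in> closure D" for k
    using side[of k] by (auto simp: side_def frontier_def)
  define m where "m = midpoint (P i) (P (i + 1))"
  have "m \<in> side P i" by (simp add: m_def side_def midpoints_in_convex_hull)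
  then have "m \<notin> D" using side[of i] D(1) by (auto simp: frontier_def interior_open)
  then obtain a where a: "a \<noteq> 0" "\<forall>x\<in>D. a \<bullet> x \<le> a \<bullet> m"
    using separating_hyperplane_sets[of D "{m}"] D by force
  have "closure D \<subseteq> {x. a \<bullet> x \<le> a \<bullet> m}"
    by (rule closure_minimal) (use a in \<open>auto simp: closed_halfspace_le\<close>)
  then have le: "a \<bullet> P k \<le> a \<bullet> m" for k using cl by auto
  have "a \<bullet> m = (a \<bullet> P i + a \<bullet> P (i + 1)) / 2"
    by (simp add: m_def midpoint_def inner_simps field_simps)
  then have ai: "a \<bullet> P i = a \<bullet> m" "a \<bullet> P (i + 1) = a \<bullet> m"
    using le[of i] le[of "i + 1"] by simp_all
  define v where "v = side_vec P i"
  have v: "v \<noteq> 0" "a \<bullet> v = 0" using assms(4) ai by (auto simp: v_def side_vec_def inner_simps)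
  \<comment> \<open>The normal \<open>a\<close> turned by a right angle spans the supporting line,
    so \<open>v\<close> is a multiple of it.\<close>
  then have "det2 (vector [- a $ 2, a $ 1]) v = 0"
    by (simp add: det2_eq inner_vec_def sum_2)
  moreover have "(vector [- a $ 2, a $ 1] :: real^2) \<noteq> 0"
    using a(1) by (auto simp: vec_eq_iff forall_2)
  ultimately obtain t where t: "v = t *\<^sub>R vector [- a $ 2, a $ 1]"
    by (rule det2_eq_0_imp_parallel)
  have "det2 v (P k - P i) = t * (a \<bullet> m - a \<bullet> P k)" for k
    unfolding t det2_eq ai(1)[symmetric] by (simp add: inner_vec_def sum_2 algebra_simps)
  then show ?thesis using le unfolding v_def[symmetric]
    by (cases "0 \<le> t") (auto simp: zero_le_mult_iff mult_le_0_iff)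
qed

text \<open>
  Multiplying by \<open>c\<close>, the common value of the determinants of consecutive sides, makes the
  estimates independent of the orientation.
\<close>

lemma vertices_left_of_edge:
  assumes P: "convex_equal_area_polygon n P"
    and c: "\<And>i. det2 (side_vec P i) (side_vec P (i + 1)) = c" "c \<noteq> 0"
    and k: "i + 1 < k" "k < i + int n"
  shows "0 < c * det2 (side_vec P i) (P k - P i)"
proof -
  have simple: "simple_polygon n P" and conv: "bounds_convex_domain n P" and n: "5 \<le> n"
    using P by (auto simp: convex_equal_area_polygon_def)
  have cp: "closed_polygon n P" using simple by (simp add: simple_polygon_def)
  have ne: "side_vec P j \<noteq> 0" for j
    using c(1)[of j] c(2) by (auto simp: det2_eq)
  \<comment> \<open>The supporting line leaves the side open; the vertex \<open>P (j + 2)\<close>,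
    where the determinant equals \<open>c\<close>, decides it.\<close>
  have nonneg: "0 \<le> c * det2 (side_vec P j) (P l - P j)" for j l
  proof -
    have "P j \<noteq> P (j + 1)" using ne[of j] by (auto simp: side_vec_def)
    moreover have "P (j + 2) - P j = side_vec P j + side_vec P (j + 1)"
      by (simp add: side_vec_def add.commute)
    then have "det2 (side_vec P j) (P (j + 2) - P j) = c"
      by (simp add: det2_algebra c)
    ultimately show ?thesis
      using edge_supporting_line[OF conv cp, of j] n c(2)
      by (auto simp: zero_le_mult_iff)
  qed
  \<comment> \<open>If \<open>P k\<close> were on the line of edge \<open>i\<close>, the half planes
    of the two neighbouring edges would force it onto the edge itself, against simplicity.\<close>
  have "det2 (side_vec P i) (P k - P i) \<noteq> 0"
  proof
    assume "det2 (side_vec P i) (P k - P i) = 0"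
    then obtain t where t: "P k - P i = t *\<^sub>R side_vec P i"
      using det2_eq_0_imp_parallel ne by metis
    have "0 \<le> t"
    proof -
      have "det2 (side_vec P (i - 1)) (P k - P (i - 1)) =
          det2 (side_vec P (i - 1)) (side_vec P (i - 1) + (P k - P i))"
        by (simp add: side_vec_def)
      also have "\<dots> = t * c" unfolding t using c(1)[of "i - 1"] by (simp add: det2_algebra)
      finally have "0 \<le> t * c\<^sup>2"
        using nonneg[of "i - 1" k] by (simp add: power2_eq_square algebra_simps)
      then show ?thesis using c(2) by (simp add: zero_le_mult_iff)
    qed
    moreover have "t \<le> 1"
    proof -
      have "P k - P (i + 1) = (t - 1) *\<^sub>R side_vec P i"
        unfolding scaleR_left_diff_distrib t[symmetric] by (simp add: side_vec_def)
      then have "det2 (side_vec P (i + 1)) (P k - P (i + 1)) =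
          (t - 1) * det2 (side_vec P (i + 1)) (side_vec P i)"
        by (simp only: det2_algebra)
      then have eq: "det2 (side_vec P (i + 1)) (P k - P (i + 1)) = (1 - t) * c"
        using c(1)[of i] det2_skew[of "side_vec P (i + 1)" "side_vec P i"] by simp argo
      have "0 \<le> (1 - t) * c\<^sup>2"
        using nonneg[of "i + 1" k] unfolding eq by (simp only: power2_eq_square mult.left_commute mult.commute)
      then show ?thesis using c(2) by (simp add: zero_le_mult_iff)
    qed
    moreover have "P k = (1 - t) *\<^sub>R P i + t *\<^sub>R P (i + 1)"
      using t by (simp add: side_vec_def algebra_simps)
    ultimately have "P k \<in> side P i" by (auto simp: side_def in_segment)
    moreover have "P k \<in> side P k" by (simp add: side_def)
    ultimately have int: "P k \<in> side P i \<inter> side P k" by blast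
    define p where "p j = j mod int n" for j
    have per: "P (p j) = P j" "P (p j + 1) = P (j + 1)" for j
      unfolding p_def by (rule closed_polygon_mod[OF cp])+
    have side: "side P (p j) = side P j" for j by (simp add: side_def per)
    have p: "p j \<in> {0..<int n}" for j using n by (simp add: p_def)
    \<comment> \<open>Both differences lie strictly between 0 and \<open>int n\<close>, so
      \<open>P k\<close> is neither endpoint of edge \<open>i\<close>.\<close>
    have "\<not> int n dvd k - i" "\<not> int n dvd k - (i + 1)"
      using k by (auto dest: zdvd_imp_le)
    then have neq: "p k \<noteq> p i" "p k \<noteq> p (i + 1)"
      unfolding p_def mod_eq_dvd_iff by simp_all
    have "side P (p i) \<inter> side P (p k) \<subseteq> {P (p i), P (p i + 1)} \<inter> {P (p k), P (p k + 1)}"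
      using simple p[of i] p[of k] neq(1) unfolding simple_polygon_def by blast
    then have "P (p k) = P (p i) \<or> P (p k) = P (p (i + 1))"
      using int unfolding side per by blast
    moreover have "inj_on P {0..<int n}" using simple by (simp add: simple_polygon_def)
    ultimately show False using p neq by (metis inj_onD)
  qed
  then show ?thesis using nonneg[of i k] c(2) by (simp add: order.strict_iff_order)
qed

text \<open>Three-term Pluecker relation, with every determinant scaled by \<open>c\<close>. For
  vectors on the positive side of \<open>u\<close>, it carries positivity from the pairs
  \<open>v\<close>, \<open>w\<close> and \<open>w\<close>, \<open>z\<close> to the pair
  \<open>v\<close>, \<open>z\<close>.\<close>

lemma det2_pluecker:
  "(c * det2 u w) * (c * det2 v z) =
    (c * det2 u v) * (c * det2 w z) + (c * det2 u z) * (c * det2 v w)"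
  by (simp add: det2_eq algebra_simps)

text \<open>
  Seen from \<open>P i\<close>, the other vertices lie in a half plane bounded by the edge at \<open>i\<close>,
  where turning left is a transitive relation.
\<close>

lemma convex_position:
  assumes P: "convex_equal_area_polygon n P"
    and c: "\<And>i. det2 (side_vec P i) (side_vec P (i + 1)) = c" "c \<noteq> 0"
    and ijk: "i < j" "j < k" "k < i + int n"
  shows "0 < c * det2 (P j - P i) (P k - P i)"
proof -
  have per: "P (l + int n) = P l" for l
    using P by (simp add: convex_equal_area_polygon_def simple_polygon_def closed_polygon_def)
  note left = vertices_left_of_edge[OF P c]
  have first: "0 < c * det2 (P (i + 1) - P i) (P l - P i)" if "i + 1 < l" "l < i + int n" for l
    using left[OF that] by (simp add: side_vec_def)
  \<comment> \<open>This is the half plane of edge \<open>l\<close> tested at \<open>P i\<close>,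
    which is addressed as \<open>P (i + int n)\<close> so that its index exceeds
    \<open>l + 1\<close>.\<close>
  have turn: "0 < c * det2 (P l - P i) (P (l + 1) - P i)" if "i < l" "l + 1 < i + int n" for l
  proof -
    have "0 < c * det2 (side_vec P l) (P (i + int n) - P l)"
      by (rule left) (use that in auto)
    moreover have "det2 (side_vec P l) (P i - P l) = det2 (P l - P i) (P (l + 1) - P i)"
      by (simp add: side_vec_def det2_eq algebra_simps)
    ultimately show ?thesis by (simp add: per)
  qed
  have "j + 1 \<le> k" using ijk by simp
  then have "k < i + int n \<longrightarrow> 0 < c * det2 (P j - P i) (P k - P i)"
  proof (induction k rule: int_ge_induct)
    case base
    then show ?case using turn ijk by simp
  next
    case (step k)
    show ?case
    \<comment> \<open>For \<open>j = i + 1\<close> the first vector is the reference edge itself,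
      and its half plane gives the claim directly.\<close>
    proof (cases "j = i + 1")
      case True
      then show ?thesis using first step.hyps by simp
    next
      case False
      show ?thesis
      proof
        assume k: "k + 1 < i + int n"
        let ?w = "\<lambda>l. P l - P i"
        have p: "0 < c * det2 (?w (i + 1)) (?w j)" "0 < c * det2 (?w k) (?w (k + 1))"
          "0 < c * det2 (?w (i + 1)) (?w (k + 1))" "0 < c * det2 (?w j) (?w k)"
          "0 < c * det2 (?w (i + 1)) (?w k)"
          using first[of j] turn[of k] first[of "k + 1"] step first[of k] k ijk False by simp_all
        have "0 < (c * det2 (?w (i + 1)) (?w j)) * (c * det2 (?w k) (?w (k + 1))) +
            (c * det2 (?w (i + 1)) (?w (k + 1))) * (c * det2 (?w j) (?w k))"
          by (rule add_pos_pos[OF mult_pos_pos[OF p(1,2)] mult_pos_pos[OF p(3,4)]])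
        also have "\<dots> = (c * det2 (?w (i + 1)) (?w k)) * (c * det2 (?w j) (?w (k + 1)))"
          by (rule det2_pluecker[symmetric])
        finally show "0 < c * det2 (?w j) (?w (k + 1))"
          by (rule zero_less_mult_pos) (rule p(5))
      qed
    qed
  qed
  then show ?thesis using ijk by simp
qed

section \<open>Sextactic edges\<close>

lemma affine_curvature_periodic:
  assumes "closed_polygon n P"
  shows "affine_curvature P (i + int n) = affine_curvature P i"
proof -
  have "P (i + int n + 2) = P (i + 2)" "P (i + int n - 1) = P (i - 1)"
    "P (i + int n + 1) = P (i + 1)" "P (i + int n) = P i"
    using assms unfolding closed_polygon_def
    by (metis add.commute add.left_commute, metis add_diff_eq add.commute diff_add_eq,
        metis add.commute add.left_commute, metis)
  then show ?thesis by (simp add: affine_curvature_def side_vec_def)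
qed

text \<open>Every linear functional on the plane is \<open>det2 u\<close> for some \<open>u\<close>,
  so these are exactly the affine functions restricted to the vertices.\<close>

definition affine_values :: "(int \<Rightarrow> real^2) \<Rightarrow> (int \<Rightarrow> real) \<Rightarrow> bool"
  where "affine_values P g \<longleftrightarrow> (\<exists>u r. \<forall>i. g i = det2 u (P i) + r)"

lemma affine_values_recurrence:
  assumes "convex_equal_area_polygon n P" "affine_values P g"
  shows "g (i + 2) - g (i - 1) = (3 - affine_curvature P i) * (g (i + 1) - g i)"
proof -
  obtain u r where g: "\<And>i. g i = det2 u (P i) + r"
    using assms(2) by (auto simp: affine_values_def)
  have "det2 u (P (i + 2) - P (i - 1)) = (3 - affine_curvature P i) * det2 u (side_vec P i)"
    unfolding affine_curvature[OF assms(1)] by (simp add: det2_algebra)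
  then show ?thesis by (simp add: g det2_algebra side_vec_def)
qed

text \<open>
  The separating line joins the midpoints of the edges preceding \<open>P k\<close> and \<open>P l\<close>; the factor
  4 clears the denominators of the midpoints.
\<close>

lemma affine_values_separate:
  assumes P: "convex_equal_area_polygon n P"
    and kl: "k < l" "l < k + int n"
  shows "\<exists>g. affine_values P g \<and> (\<forall>i\<in>{k..<l}. g i < 0) \<and> (\<forall>i\<in>{l..<k + int n}. 0 < g i)"
proof -
  have n: "5 \<le> n" and per: "P (i + int n) = P i" for i
    using P by (simp_all add: convex_equal_area_polygon_def simple_polygon_def closed_polygon_def)
  define c where "c = det2 (side_vec P 0) (side_vec P 1)"
  have c: "det2 (side_vec P i) (side_vec P (i + 1)) = c" for i
  proof (induction i rule: int_induct[where k = 0])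
    case (step1 i)
    then show ?case using P unfolding convex_equal_area_polygon_def
      by (metis add_diff_cancel_right')
  next
    case (step2 i)
    then show ?case using P unfolding convex_equal_area_polygon_def by (metis diff_add_cancel)
  qed (simp add: c_def)
  have "c \<noteq> 0"
  proof
    assume "c = 0"
    then have "det2 (P 1 - P 0) (P 2 - P 1) = 0"
      using c[of 0] by (simp add: side_vec_def)
    then have "det2 (P 0 - P 1) (P 2 - P 1) = 0" by (simp add: det2_eq algebra_simps)
    then have "collinear {0, P 0 - P 1, P 2 - P 1}"
      using det2_eq_0_imp_parallel unfolding collinear_lemma by metis
    then have "collinear {P 0, P 1, P 2}" by (subst collinear_3) (simp_all add: NO_MATCH_def)
    moreover have "\<not> collinear {P (1 - 1), P 1, P (1 + 1)}"
      using P unfolding convex_equal_area_polygon_def by blast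
    ultimately show False by simp
  qed
  define S where "S x y z = c * det2 (P y - P x) (P z - P x)" for x y z
  have pos: "0 < S x y z" if "x < y" "y < z" "z < x + int n" for x y z
    unfolding S_def by (rule convex_position[OF P c \<open>c \<noteq> 0\<close> that])
  have swap: "S x z y = - S x y z" for x y z
    by (simp add: S_def det2_eq algebra_simps)
  \<comment> \<open>The weak form admits coinciding vertices, including the wrap-around
    \<open>z = x + int n\<close>; there \<open>S\<close> vanishes.\<close>
  have nonneg: "0 \<le> S x y z" if "x \<le> y" "y \<le> z" "z \<le> x + int n" for x y z
  proof (cases "x = y \<or> y = z \<or> z = x + int n")
    case True
    then show ?thesis by (auto simp: S_def det2_eq per)
  next
    case False
    then show ?thesis using pos[of x y z] that by simp
  qed
  define A where "A = P (k - 1) + P k"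
  define B where "B = P (l - 1) + P l"
  define g where "g i = c * det2 (B - A) (2 *\<^sub>R P i - A)" for i
  \<comment> \<open>Signed area is affine in each corner, so replacing two corners by edge midpoints
    averages over the four choices of endpoints.\<close>
  have g: "g i = S (k - 1) (l - 1) i + S (k - 1) l i + S k (l - 1) i + S k l i" for i
    by (simp add: g_def S_def A_def B_def det2_eq algebra_simps)
  have "affine_values P g"
    unfolding affine_values_def
    by (rule exI[of _ "(2 * c) *\<^sub>R (B - A)"], rule exI[of _ "- c * det2 (B - A) A"])
      (simp add: g_def det2_algebra algebra_simps)
  moreover have "g i < 0" if i: "k \<le> i" "i < l" for i
  proof -
    have "0 \<le> S (k - 1) i (l - 1)" "0 \<le> S (k - 1) i l" "0 \<le> S k i (l - 1)" "0 \<le> S k i l"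
      using i kl by (auto intro!: nonneg)
    \<comment> \<open>The first term degenerates only for \<open>i = l - 1\<close>, the second then
      only for \<open>l = k + int n - 1\<close>; in that case \<open>n\<close> is large enough for
      \<open>k < i\<close>, and the third is positive.\<close>
    moreover have "0 < S (k - 1) i (l - 1) \<or> 0 < S (k - 1) i l \<or> 0 < S k i l"
      using pos[of "k - 1" i "l - 1"] pos[of "k - 1" i l] pos[of k i l] i kl n by linarith
    ultimately show ?thesis
      using swap[of "k - 1" i "l - 1"] swap[of "k - 1" i l] swap[of k i "l - 1"] swap[of k i l]
      unfolding g by linarith
  qed
  moreover have "0 < g i" if i: "l \<le> i" "i < k + int n" for i
  proof -
    have "0 \<le> S (k - 1) (l - 1) i" "0 \<le> S (k - 1) l i" "0 \<le> S k (l - 1) i" "0 \<le> S k l i"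
      using i kl by (auto intro!: nonneg)
    \<comment> \<open>The first term degenerates only for \<open>i = k + int n - 1\<close>, the
      second then only for \<open>l = k + 1\<close>, which leaves the third positive.\<close>
    moreover have "0 < S (k - 1) (l - 1) i \<or> 0 < S k (l - 1) i \<or> 0 < S k l i"
      using pos[of "k - 1" "l - 1" i] pos[of k "l - 1" i] pos[of k l i] i kl n by linarith
    ultimately show ?thesis unfolding g by linarith
  qed
  ultimately show ?thesis by auto
qed

theorem theorem4p2:
  fixes P :: "int \<Rightarrow> real^2" and n :: nat
  assumes "6 \<le> n"
    and "convex_equal_area_polygon n P"
  shows "6 \<le> card {i \<in> {1..int n}. sextactic P i}"
proof -
  have cp: "closed_polygon n P"
    using assms(2) by (simp add: convex_equal_area_polygon_def simple_polygon_def)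
  note \<mu> = affine_curvature_periodic[OF cp]
  have per: "g (i + int n) = g i" if "affine_values P g" for g i
    using that cp by (auto simp: affine_values_def closed_polygon_def)
  show ?thesis unfolding sextactic_def
  proof (rule six_sign_changes[where sol = "affine_values P"])
    show "curvature_diff P (i + int n) = curvature_diff P i" for i
      using \<mu>[of i] \<mu>[of "i - 1"] by (simp add: curvature_diff_def algebra_simps)
    show "affine_values P (\<lambda>_. 1)"
      unfolding affine_values_def by (intro exI[of _ 0] exI[of _ 1]) (simp add: det2_eq)
    show "(\<Sum>i\<in>{a..<a + int n}. curvature_diff P i * g i * h i) = 0"
      if "affine_values P g" "affine_values P h" for g h a
      unfolding curvature_diff_def
      by (rule orthogonal_product_of_solutions)
        (use that per \<mu> affine_values_recurrence[OF assms(2)] in auto)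
  qed (use per affine_values_separate[OF assms(2)] assms(1) in auto)
qed

end
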